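(* Let $U\subset C^1$ be open, let $f:U\to\mathbb{R}^n$ be $C^1_F$-smooth with property (e), let $\bar\phi\in X$ be a stationary point of the semiflow $\Sigma:\Omega\to X$ generated by $x'(t)=f(x_t)$ on $X=\{\phi\in U:\phi'(0)=f(\phi)\}$, assume $C_{d,c}\neq\{0\}$, and let the $C^1_F$-submanifold $W^c\subset X$ of $C^1$ and the open neighbourhood $U_\ast$ of $\bar\phi$ be as described in the context. Then the following holds. (i) (Local positive invariance) For every $(t,\psi)\in\Omega$ with $\psi\in W^c$ and $\Sigma([0,t]\times\{\psi\})\subset U_\ast$ we have $\Sigma([0,t]\times\{\psi\})\subset W^c$. (ii) For every solution $y:\mathbb{R}\to\mathbb{R}^n$ of $x'(t)=f(x_t)$ on $\mathbb{R}$ with $y_t\in U_\ast$ for all $t\in\mathbb{R}$ we have $y_t\in W^c$ for all $t\in\mathbb{R}$.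
   Context: Spaces. $C$, $C^1$ are the Fréchet spaces of continuous, respectively continuously differentiable, maps $(-\infty,0]\to\mathbb{R}^n$ with locally uniform convergence of maps, respectively of maps and derivatives. For $d>0$, $C_d$ and $C^1_d$ are the Banach spaces of continuous, respectively continuously differentiable, maps $[-d,0]\to\mathbb{R}^n$, the latter with $|\phi|_{d,1}=\max|\phi|+\max|\phi'|$. $R_{d,1}:C^1\to C^1_d$ is restriction to $[-d,0]$, and $P_{d,1}:C^1_d\to C^1$ is $(P_{d,1}\phi)(s)=\phi(s)$ on $[-d,0]$, $(P_{d,1}\phi)(s)=\phi(-d)+(s+d)\phi'(-d)$ for $s<-d$. Segments: $x_t(s)=x(t+s)$, for $s\le0$ when the equation is posed in $C^1$ and for $s\in[-d,0]$ when it is posed in $C^1_d$ or $C_d$. A solution on an interval $I$ of $x'(t)=f(x_t)$ is a map $x$ on $(-\infty,0]+I$ with $x_t\in U$ for $t\in I$, differentiable on $I$, and satisfying the equation there. $C^1_F$-smoothness. For topological vector spaces $E,W$, $L_c(E,W)$ (continuous linear maps) carries the topology $\beta$ of uniform convergence on bounded sets. A continuous map $h:E\supset O\to W$, $O$ open, is $C^1_F$-smooth if all directional derivatives $Dh(u)v=\lim_{0\ne t\to0}\frac1t(h(u+tv)-h(u))$ exist, each $Dh(u)$ is linear and continuous, and $O\ni u\mapsto Dh(u)\in L_c(E,W)$ is $\beta$-continuous. A subset $M$ of a Fréchet space $F=G\oplus H$ ($G,H$ closed) is a $C^1_F$-submanifold if each $m\in M$ has an open neighbourhood $O$ in $F$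 with an injective $C^1_F$-map $K$ of $O$ onto an open set $W\subset F$, with $C^1_F$-smooth inverse, such that $K(M\cap O)=W\cap G$. $T_mM$ is the set of tangent vectors $c'(0)$ of continuously differentiable curves in $M$ through $c(0)=m$. Property (e) of $f$: each $Df(\phi):C^1\to\mathbb{R}^n$, $\phi\in U$, has a linear extension $D_ef(\phi):C\to\mathbb{R}^n$ such that $U\times C\ni(\phi,\chi)\mapsto D_ef(\phi)\chi\in\mathbb{R}^n$ is continuous. Semiflow. For $\phi\in X$ let $x^\phi:(-\infty,t_\phi)\to\mathbb{R}^n$ be the maximal solution on $[0,t_\phi)$ of $x'(t)=f(x_t)$ with $x_0=\phi$; $\Omega=\{(t,\phi)\in[0,\infty)\times X:t<t_\phi\}$ and $\Sigma(t,\phi)=x^\phi_t$ define a continuous semiflow on $X$. $\bar\phi\in X$ is a stationary point if $\Sigma(t,\bar\phi)=\bar\phi$ for all $t\ge0$; then $\bar\phi$ is constant. Choice of $N$, $d$, $U_d$. Fix an open neighbourhood $N\subset U$ of $\bar\phi$ and $d>0$ such that $f(\chi)=f(\psi)$ for all $\chi,\psi\in N$ with $\chi=\psi$ on $[-d,0]$ (these are known to exist). Put $\bar\phi_d=R_{d,1}\bar\phi$, fix an open neighbourhood $U_d$ of $\bar\phi_d$ in $C^1_d$ with $P_{d,1}U_d\subset N$, and let $f_d:U_d\to\mathbb{R}^n$, $f_d(\phi)=f(P_{d,1}\phi)$. $Df_d(\bar\phi_d)$ has a continuous linear extension $D_ef_d(\bar\phi_d):C_d\to\mathbb{R}^n$.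 Let $C_d=C_{d,s}\oplus C_{d,c}\oplus C_{d,u}$ be the decomposition into linear stable, center and unstable spaces of the strongly continuous semigroup on $C_d$ given by the solutions of $v'(t)=D_ef_d(\bar\phi_d)v_t$ (spectral subspaces for the parts of the spectrum of the generator with negative, zero, positive real part); $C_{d,c}$ and $C_{d,u}$ are finite-dimensional subspaces of $C^1_d$. Each $\chi\in C_{d,c}$ uniquely determines an analytic solution $v^\chi$ on $\mathbb{R}$ of this linear equation with $v^\chi|_{[-d,0]}=\chi$ and all segments on $[-d,0]$ in $C_{d,c}$; put $Y_c=\{v^\chi|_{(-\infty,0]}:\chi\in C_{d,c}\}$. Construction of $W^c$. Let $V_d=U_d-\bar\phi_d$ and $g_d:V_d\to\mathbb{R}^n$, $g_d(\phi)=f_d(\bar\phi_d+\phi)$, so $g_d(0)=0$ and $Dg_d(0)=Df_d(\bar\phi_d)$. Let $P^1_{d,c}:C^1_d\to C^1_d$ be the projection onto $C_{d,c}$ given by $C^1_d=(C^1_d\cap C_{d,s})\oplus C_{d,c}\oplus C_{d,u}$, and let $\|\cdot\|_{d,1}$ be a norm on $C^1_d$ equivalent to $|\cdot|_{d,1}$ whose restriction to $C_{d,c}\setminus\{0\}$ is $C^\infty$-smooth. For $\Delta>0$ let $N_\Delta=\{\phi\in C^1_d:\|\phi\|_{d,1}<\Delta\}$. By known results there are $\Delta>0$ with $N_\Delta\subset V_d$, a continuation $r_{d,\Delta}:C^1_d\to\mathbb{R}^n$ of the map $N_\Delta\ni\phi\mapsto g_d(\phi)-Dg_d(0)\phi$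 which is Lipschitz continuous with Lipschitz constant (with respect to $\|\cdot\|_{d,1}$) less than $1$, and $\eta_1>0$, such that for every $\phi\in C_{d,c}$ there is a unique continuously differentiable map $x^{[\phi]}:\mathbb{R}\to\mathbb{R}^n$ which satisfies $$x'(t)=Dg_d(0)x_t+r_{d,\Delta}(x_t)\quad(\text{segments in }C^1_d)$$ for all $t\in\mathbb{R}$, $P^1_{d,c}x^{[\phi]}_0=\phi$, and $\sup_{t\in\mathbb{R}}e^{-\eta_1|t|}|x^{[\phi]}_t|_{d,1}<\infty$; moreover $x^{[0]}=0$, and the map $$J:C_{d,c}\ni\phi\mapsto\bar\phi+x^{[\phi]}|_{(-\infty,0]}\in C^1$$ is $C^1_F$-smooth with $DJ(0)\chi=v^\chi|_{(-\infty,0]}$ for all $\chi\in C_{d,c}$. Fix such data. $N_{d,c}$ is an open neighbourhood of $0$ in $C_{d,c}$ such that $W^c=J(N_{d,c})$ is a $C^1_F$-submanifold of $C^1$ with $T_{\bar\phi}W^c=Y_c$, $J(N_{d,c})\subset N$, and $\|x^{[\phi]}_0\|_{d,1}<\Delta$ for all $\phi\in N_{d,c}$ (segments on $[-d,0]$). One has $W^c\subset X$. Finally, $U_\ast$ is an open neighbourhood of $\bar\phi$ in $N$ such that $R_{d,1}U_\ast\subset U_d\cap(N_\Delta+\bar\phi_d)$ and $P^1_{d,c}R_{d,1}(\psi-\bar\phi)\in N_{d,c}$ for all $\psi\in U_\ast$. *)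

theory Defs
  imports "HOL-Analysis.Analysis" "HOL-Library.Function_Algebras"
begin

text \<open>
  Maps on an interval \<open>I\<close> of reals are represented by their extension by \<open>0\<close> to all reals. So
  equality of maps on \<open>I\<close> is equality of functions, and all the function spaces below are linear
  subspaces of \<open>real \<Rightarrow> 'b\<close> with the pointwise operations. A topological vector space is
  given by a topology whose \<open>topspace\<close> is a linear subspace of a type of class \<open>real_vector\<close>.
\<close>

instantiation "fun" :: (type, real_vector) real_vector
begin

definition scaleR_fun :: "real \<Rightarrow> ('a \<Rightarrow> 'b) \<Rightarrow> 'a \<Rightarrow> 'b" where
  "scaleR_fun c f = (\<lambda>x. c *\<^sub>R f x)"

instance
  by standard (auto simp: scaleR_fun_def plus_fun_def fun_eq_iff scaleR_add_right scaleR_add_left)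

end


section \<open>Topological vector spaces and \<open>C\<^sup>1\<^sub>F\<close>-smoothness\<close>

definition seminorm_topology :: "'a::real_vector set \<Rightarrow> ('a \<Rightarrow> real) set \<Rightarrow> 'a topology" where
  "seminorm_topology E P = topology (\<lambda>S. S \<subseteq> E \<and>
     (\<forall>x\<in>S. \<exists>F e. finite F \<and> F \<subseteq> P \<and> 0 < e \<and> {y\<in>E. \<forall>p\<in>F. p (y - x) < e} \<subseteq> S))"

lemma openin_seminorm_topology:
  "openin (seminorm_topology E P) S \<longleftrightarrow> S \<subseteq> E \<and>
     (\<forall>x\<in>S. \<exists>F e. finite F \<and> F \<subseteq> P \<and> 0 < e \<and> {y\<in>E. \<forall>p\<in>F. p (y - x) < e} \<subseteq> S)"
proof -
  let ?B = "\<lambda>x F e. {y\<in>E. \<forall>p\<in>F. p (y - x) < (e::real)}"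
  let ?Q = "\<lambda>S. S \<subseteq> E \<and> (\<forall>x\<in>S. \<exists>F e. finite F \<and> F \<subseteq> P \<and> 0 < e \<and> ?B x F e \<subseteq> S)"
  have "istopology ?Q"
    unfolding istopology_def
  proof (intro conjI allI impI)
    fix S T assume S: "?Q S" and T: "?Q T"
    show "S \<inter> T \<subseteq> E" using S by blast
    show "\<forall>x\<in>S \<inter> T. \<exists>F e. finite F \<and> F \<subseteq> P \<and> 0 < e \<and> ?B x F e \<subseteq> S \<inter> T"
    proof
      fix x assume x: "x \<in> S \<inter> T"
      from S x obtain F1 e1 where 1: "finite F1" "F1 \<subseteq> P" "0 < e1" "?B x F1 e1 \<subseteq> S" by blast
      from T x obtain F2 e2 where 2: "finite F2" "F2 \<subseteq> P" "0 < e2" "?B x F2 e2 \<subseteq> T" by blast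
      have "?B x (F1 \<union> F2) (min e1 e2) \<subseteq> ?B x F1 e1 \<inter> ?B x F2 e2" by auto
      then have "?B x (F1 \<union> F2) (min e1 e2) \<subseteq> S \<inter> T" using 1(4) 2(4) by blast
      moreover have "finite (F1 \<union> F2)" "F1 \<union> F2 \<subseteq> P" "0 < min e1 e2" using 1 2 by simp_all
      ultimately show "\<exists>F e. finite F \<and> F \<subseteq> P \<and> 0 < e \<and> ?B x F e \<subseteq> S \<inter> T" by blast
    qed
  next
    fix \<K> assume K: "\<forall>S\<in>\<K>. ?Q S"
    then show "\<Union>\<K> \<subseteq> E" by blast
    show "\<forall>x\<in>\<Union>\<K>. \<exists>F e. finite F \<and> F \<subseteq> P \<and> 0 < e \<and> ?B x F e \<subseteq> \<Union>\<K>"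
    proof
      fix x assume "x \<in> \<Union>\<K>"
      then obtain S where S: "S \<in> \<K>" "x \<in> S" by blast
      then have "\<exists>F e. finite F \<and> F \<subseteq> P \<and> 0 < e \<and> ?B x F e \<subseteq> S" using K by simp
      then obtain F e where "finite F" "F \<subseteq> P" "0 < e" "?B x F e \<subseteq> S" by (elim exE conjE)
      moreover have "S \<subseteq> \<Union>\<K>" using S by blast
      ultimately show "\<exists>F e. finite F \<and> F \<subseteq> P \<and> 0 < e \<and> ?B x F e \<subseteq> \<Union>\<K>"
        by (meson order_trans)
    qed
  qed
  then show ?thesis
    unfolding seminorm_topology_def by (simp add: topology_inverse')
qed

lemma topspace_seminorm_topology [simp]: "topspace (seminorm_topology E P) = E"
proof -
  have "openin (seminorm_topology E P) E"
    unfolding openin_seminorm_topology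
    by (intro conjI ballI exI[of _ "{}"] exI[of _ "1::real"]) auto
  then show ?thesis
    by (metis openin_seminorm_topology openin_subset openin_topspace subset_antisym)
qed

definition linear_between :: "'a::real_vector set \<Rightarrow> 'b::real_vector set \<Rightarrow> ('a \<Rightarrow> 'b) \<Rightarrow> bool" where
  "linear_between E W T \<longleftrightarrow> T ` E \<subseteq> W \<and> (\<forall>x\<in>E. \<forall>y\<in>E. T (x + y) = T x + T y) \<and>
     (\<forall>c. \<forall>x\<in>E. T (c *\<^sub>R x) = c *\<^sub>R T x)"

definition continuous_linear_between ::
    "'a::real_vector topology \<Rightarrow> 'b::real_vector topology \<Rightarrow> ('a \<Rightarrow> 'b) \<Rightarrow> bool" where
  "continuous_linear_between E W T \<longleftrightarrow>
     linear_between (topspace E) (topspace W) T \<and> continuous_map E W T"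

definition Lc :: "'a::real_vector topology \<Rightarrow> 'b::real_vector topology \<Rightarrow> ('a \<Rightarrow> 'b) set" where
  "Lc E W = {T \<in> extensional (topspace E). continuous_linear_between E W T}"

definition tvs_bounded :: "'a::real_vector topology \<Rightarrow> 'a set \<Rightarrow> bool" where
  "tvs_bounded E B \<longleftrightarrow> B \<subseteq> topspace E \<and>
     (\<forall>Q. openin E Q \<and> 0 \<in> Q \<longrightarrow> (\<exists>s>0. \<forall>t>s. B \<subseteq> (\<lambda>x. t *\<^sub>R x) ` Q))"

definition beta_topology ::
    "'a::real_vector topology \<Rightarrow> 'b::real_vector topology \<Rightarrow> ('a \<Rightarrow> 'b) topology" where
  "beta_topology E W = topology (\<lambda>S. S \<subseteq> Lc E W \<and>
     (\<forall>T\<in>S. \<exists>B Q. tvs_bounded E B \<and> openin W Q \<and> 0 \<in> Q \<and>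
        {T'\<in>Lc E W. \<forall>b\<in>B. T' b - T b \<in> Q} \<subseteq> S))"

lemma tvs_bounded_Un:
  assumes "tvs_bounded E A" "tvs_bounded E B" shows "tvs_bounded E (A \<union> B)"
  unfolding tvs_bounded_def
proof (intro conjI allI impI)
  show "A \<union> B \<subseteq> topspace E" using assms by (auto simp: tvs_bounded_def)
  fix Q assume Q: "openin E Q \<and> 0 \<in> Q"
  from assms(1) Q obtain s1 where 1: "s1 > 0" "\<forall>t>s1. A \<subseteq> (\<lambda>x. t *\<^sub>R x) ` Q"
    unfolding tvs_bounded_def by blast
  from assms(2) Q obtain s2 where 2: "s2 > 0" "\<forall>t>s2. B \<subseteq> (\<lambda>x. t *\<^sub>R x) ` Q"
    unfolding tvs_bounded_def by blast
  show "\<exists>s>0. \<forall>t>s. A \<union> B \<subseteq> (\<lambda>x. t *\<^sub>R x) ` Q"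
    using 1 2 by (intro exI[of _ "max s1 s2"]) (auto simp: less_max_iff_disj)
qed

lemma openin_beta_topology:
  "openin (beta_topology E W) S \<longleftrightarrow> S \<subseteq> Lc E W \<and>
     (\<forall>T\<in>S. \<exists>B Q. tvs_bounded E B \<and> openin W Q \<and> 0 \<in> Q \<and>
        {T'\<in>Lc E W. \<forall>b\<in>B. T' b - T b \<in> Q} \<subseteq> S)"
proof -
  let ?B = "\<lambda>T B Q. {T'\<in>Lc E W. \<forall>b\<in>B. T' b - T b \<in> Q}"
  let ?R = "\<lambda>T B Q S. tvs_bounded E B \<and> openin W Q \<and> 0 \<in> Q \<and> ?B T B Q \<subseteq> S"
  let ?Q = "\<lambda>S. S \<subseteq> Lc E W \<and> (\<forall>T\<in>S. \<exists>B Q. ?R T B Q S)"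
  have "istopology ?Q"
    unfolding istopology_def
  proof (intro conjI allI impI)
    fix S1 S2 assume S1: "?Q S1" and S2: "?Q S2"
    show "S1 \<inter> S2 \<subseteq> Lc E W" using S1 by blast
    show "\<forall>T\<in>S1 \<inter> S2. \<exists>B Q. ?R T B Q (S1 \<inter> S2)"
    proof
      fix T assume T: "T \<in> S1 \<inter> S2"
      from S1 T obtain B1 Q1 where 1: "?R T B1 Q1 S1" by blast
      from S2 T obtain B2 Q2 where 2: "?R T B2 Q2 S2" by blast
      have "?B T (B1 \<union> B2) (Q1 \<inter> Q2) \<subseteq> ?B T B1 Q1 \<inter> ?B T B2 Q2" by auto
      then have "?B T (B1 \<union> B2) (Q1 \<inter> Q2) \<subseteq> S1 \<inter> S2" using 1 2 by blast
      moreover have "tvs_bounded E (B1 \<union> B2)" "openin W (Q1 \<inter> Q2)" "0 \<in> Q1 \<inter> Q2"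
        using 1 2 tvs_bounded_Un by auto
      ultimately have "?R T (B1 \<union> B2) (Q1 \<inter> Q2) (S1 \<inter> S2)" by blast
      then show "\<exists>B Q. ?R T B Q (S1 \<inter> S2)" by blast
    qed
  next
    fix \<K> assume K: "\<forall>S\<in>\<K>. ?Q S"
    then show "\<Union>\<K> \<subseteq> Lc E W" by blast
    show "\<forall>T\<in>\<Union>\<K>. \<exists>B Q. ?R T B Q (\<Union>\<K>)"
    proof
      fix T assume "T \<in> \<Union>\<K>"
      then obtain S where S: "S \<in> \<K>" "T \<in> S" by blast
      then have "\<exists>B Q. ?R T B Q S" using K by simp
      then obtain B Q where "?R T B Q S" by (elim exE)
      moreover have "S \<subseteq> \<Union>\<K>" using S by blast
      ultimately have "?R T B Q (\<Union>\<K>)" by (meson order_trans)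
      then show "\<exists>B Q. ?R T B Q (\<Union>\<K>)" by (intro exI)
    qed
  qed
  then show ?thesis
    unfolding beta_topology_def by (simp add: topology_inverse')
qed

definition has_dirderiv ::
    "'b::real_vector topology \<Rightarrow> ('a::real_vector \<Rightarrow> 'b) \<Rightarrow> 'a \<Rightarrow> 'a \<Rightarrow> 'b \<Rightarrow> bool" where
  "has_dirderiv W h u v l \<longleftrightarrow> limitin W (\<lambda>t. (1 / t) *\<^sub>R (h (u + t *\<^sub>R v) - h u)) l (at (0::real))"

definition dirderiv ::
    "'b::real_vector topology \<Rightarrow> ('a::real_vector \<Rightarrow> 'b) \<Rightarrow> 'a \<Rightarrow> 'a \<Rightarrow> 'b" where
  "dirderiv W h u v = (THE l. has_dirderiv W h u v l)"

definition C1F_on ::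
    "'a::real_vector topology \<Rightarrow> 'b::real_vector topology \<Rightarrow> 'a set \<Rightarrow> ('a \<Rightarrow> 'b) \<Rightarrow> bool" where
  "C1F_on E W Q h \<longleftrightarrow> openin E Q \<and> continuous_map (subtopology E Q) W h \<and>
     (\<forall>u\<in>Q. \<forall>v\<in>topspace E. \<exists>l. has_dirderiv W h u v l) \<and>
     (\<forall>u\<in>Q. continuous_linear_between E W (dirderiv W h u)) \<and>
     continuous_map (subtopology E Q) (beta_topology E W)
       (\<lambda>u. restrict (dirderiv W h u) (topspace E))"

definition closed_complements :: "'a::real_vector topology \<Rightarrow> 'a set \<Rightarrow> 'a set \<Rightarrow> bool" where
  "closed_complements F G H \<longleftrightarrow> subspace G \<and> subspace H \<and> closedin F G \<and> closedin F H \<and>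
     (\<forall>x\<in>topspace F. \<exists>!(p, q). p \<in> G \<and> q \<in> H \<and> x = p + q)"

definition C1F_submanifold :: "'a::real_vector topology \<Rightarrow> 'a set \<Rightarrow> bool" where
  "C1F_submanifold F M \<longleftrightarrow> M \<subseteq> topspace F \<and>
     (\<exists>G H. closed_complements F G H \<and>
       (\<forall>m\<in>M. \<exists>Q K W. openin F Q \<and> m \<in> Q \<and> openin F W \<and>
          bij_betw K Q W \<and> C1F_on F F Q K \<and> C1F_on F F W (inv_into Q K) \<and>
          K ` (M \<inter> Q) = W \<inter> G))"

definition tangent_set :: "'a::real_vector topology \<Rightarrow> 'a set \<Rightarrow> 'a \<Rightarrow> 'a set" where
  "tangent_set F M m = {v. \<exists>c c' e. 0 < e \<and> c (0::real) = m \<and> c' 0 = v \<and>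
     (\<forall>t\<in>{-e<..<e}. c t \<in> M \<and> limitin F (\<lambda>h. (1 / h) *\<^sub>R (c (t + h) - c t)) (c' t) (at 0)) \<and>
     continuous_map (top_of_set {-e<..<e}) F c'}"

text \<open>
  \<open>C\<^sup>k\<close>-smoothness of a real function on an open subset of a finite-dimensional space \<open>E\<close>, by
  iterated directional derivatives.
\<close>

primrec Ck_on :: "nat \<Rightarrow> 'a::real_vector topology \<Rightarrow> 'a set \<Rightarrow> ('a \<Rightarrow> real) \<Rightarrow> bool" where
  "Ck_on 0 E Q h \<longleftrightarrow> continuous_map (subtopology E Q) euclidean h"
| "Ck_on (Suc k) E Q h \<longleftrightarrow> continuous_map (subtopology E Q) euclidean h \<and>
     (\<forall>v\<in>topspace E. (\<forall>u\<in>Q. \<exists>l. has_dirderiv euclidean h u v l) \<and>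
        Ck_on k E Q (\<lambda>u. dirderiv euclidean h u v))"

definition norm_on :: "'a::real_vector set \<Rightarrow> ('a \<Rightarrow> real) \<Rightarrow> bool" where
  "norm_on E p \<longleftrightarrow> (\<forall>x\<in>E. 0 \<le> p x \<and> (p x = 0 \<longleftrightarrow> x = 0)) \<and>
     (\<forall>c. \<forall>x\<in>E. p (c *\<^sub>R x) = \<bar>c\<bar> * p x) \<and> (\<forall>x\<in>E. \<forall>y\<in>E. p (x + y) \<le> p x + p y)"

definition equivalent_norms :: "'a set \<Rightarrow> ('a \<Rightarrow> real) \<Rightarrow> ('a \<Rightarrow> real) \<Rightarrow> bool" where
  "equivalent_norms E p q \<longleftrightarrow> (\<exists>a>0. \<exists>b>0. \<forall>x\<in>E. a * q x \<le> p x \<and> p x \<le> b * q x)"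


section \<open>Spaces of maps on intervals\<close>

definition restr :: "real set \<Rightarrow> (real \<Rightarrow> 'b::zero) \<Rightarrow> real \<Rightarrow> 'b" where
  "restr I x = (\<lambda>s. if s \<in> I then x s else 0)"

definition segm :: "real set \<Rightarrow> (real \<Rightarrow> 'b::zero) \<Rightarrow> real \<Rightarrow> real \<Rightarrow> 'b" where
  "segm I x t = restr I (\<lambda>s. x (t + s))"

definition deriv_on :: "real set \<Rightarrow> (real \<Rightarrow> 'b::real_normed_vector) \<Rightarrow> real \<Rightarrow> 'b" where
  "deriv_on I \<phi> s = vector_derivative \<phi> (at s within I)"

definition C0_on :: "real set \<Rightarrow> (real \<Rightarrow> 'b::real_normed_vector) set" where
  "C0_on I = {\<phi>. (\<forall>s. s \<notin> I \<longrightarrow> \<phi> s = 0) \<and> continuous_on I \<phi>}"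

definition C1_on :: "real set \<Rightarrow> (real \<Rightarrow> 'b::real_normed_vector) set" where
  "C1_on I = {\<phi>. (\<forall>s. s \<notin> I \<longrightarrow> \<phi> s = 0) \<and>
     (\<exists>\<phi>'. continuous_on I \<phi>' \<and> (\<forall>s\<in>I. (\<phi> has_vector_derivative \<phi>' s) (at s within I)))}"

definition sup_norm :: "real set \<Rightarrow> (real \<Rightarrow> 'b::real_normed_vector) \<Rightarrow> real" where
  "sup_norm K \<phi> = (SUP s\<in>K. norm (\<phi> s))"

definition C_top :: "(real \<Rightarrow> 'b::real_normed_vector) topology" where
  "C_top = seminorm_topology (C0_on {..0}) {sup_norm {-k..0} |k. 0 < k}"

definition C1_top :: "(real \<Rightarrow> 'b::real_normed_vector) topology" where
  "C1_top = seminorm_topology (C1_on {..0})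
     {(\<lambda>\<phi>. sup_norm {-k..0} \<phi> + sup_norm {-k..0} (deriv_on {..0} \<phi>)) |k. 0 < k}"

definition norm_d1 :: "real \<Rightarrow> (real \<Rightarrow> 'b::real_normed_vector) \<Rightarrow> real" where
  "norm_d1 d \<phi> = sup_norm {-d..0} \<phi> + sup_norm {-d..0} (deriv_on {-d..0} \<phi>)"

definition Cd_top :: "real \<Rightarrow> (real \<Rightarrow> 'b::real_normed_vector) topology" where
  "Cd_top d = seminorm_topology (C0_on {-d..0}) {sup_norm {-d..0}}"

definition C1d_top :: "real \<Rightarrow> (real \<Rightarrow> 'b::real_normed_vector) topology" where
  "C1d_top d = seminorm_topology (C1_on {-d..0}) {norm_d1 d}"

definition R_d1 :: "real \<Rightarrow> (real \<Rightarrow> 'b::real_normed_vector) \<Rightarrow> real \<Rightarrow> 'b" where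
  "R_d1 d \<phi> = restr {-d..0} \<phi>"

definition P_d1 :: "real \<Rightarrow> (real \<Rightarrow> 'b::real_normed_vector) \<Rightarrow> real \<Rightarrow> 'b" where
  "P_d1 d \<phi> = restr {..0}
     (\<lambda>s. if -d \<le> s then \<phi> s else \<phi> (-d) + (s + d) *\<^sub>R deriv_on {-d..0} \<phi> (-d))"


section \<open>The delay differential equation and its semiflow\<close>

definition property_e ::
    "(real \<Rightarrow> 'b::real_normed_vector) set \<Rightarrow> ((real \<Rightarrow> 'b) \<Rightarrow> 'b) \<Rightarrow> bool" where
  "property_e U f \<longleftrightarrow> (\<exists>De.
     (\<forall>\<phi>\<in>U. linear_between (C0_on {..0}) UNIV (De \<phi>) \<and>
        (\<forall>\<xi>\<in>C1_on {..0}. De \<phi> \<xi> = dirderiv euclidean f \<phi> \<xi>)) \<and>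
     continuous_map (prod_topology (subtopology C1_top U) C_top) euclidean
       (\<lambda>(\<phi>, \<xi>). De \<phi> \<xi>))"

definition solution_manifold ::
    "(real \<Rightarrow> 'b::real_normed_vector) set \<Rightarrow> ((real \<Rightarrow> 'b) \<Rightarrow> 'b) \<Rightarrow> (real \<Rightarrow> 'b) set" where
  "solution_manifold U f = {\<phi>\<in>U. deriv_on {..0} \<phi> 0 = f \<phi>}"

text \<open>Only the values of \<open>x\<close> on \<open>{..0} + I\<close> matter.\<close>

definition is_solution ::
    "(real \<Rightarrow> 'b::real_normed_vector) set \<Rightarrow> ((real \<Rightarrow> 'b) \<Rightarrow> 'b) \<Rightarrow> real set \<Rightarrow> (real \<Rightarrow> 'b) \<Rightarrow> bool" where
  "is_solution U f I x \<longleftrightarrow> (\<forall>t\<in>I. segm {..0} x t \<in> U \<and>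
     (x has_vector_derivative f (segm {..0} x t)) (at t within I))"

definition maximal_solution ::
    "(real \<Rightarrow> 'b::real_normed_vector) set \<Rightarrow> ((real \<Rightarrow> 'b) \<Rightarrow> 'b) \<Rightarrow> (real \<Rightarrow> 'b) \<Rightarrow>
      ereal \<Rightarrow> (real \<Rightarrow> 'b) \<Rightarrow> bool" where
  "maximal_solution U f \<phi> te x \<longleftrightarrow>
     0 < te \<and> is_solution U f {t. 0 \<le> t \<and> ereal t < te} x \<and> segm {..0} x 0 = \<phi> \<and>
     (\<forall>te' y. 0 < te' \<and> is_solution U f {t. 0 \<le> t \<and> ereal t < te'} y \<and> segm {..0} y 0 = \<phi> \<longrightarrow>
        te' \<le> te \<and> (\<forall>t. ereal t < te' \<longrightarrow> y t = x t))"

text \<open>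
  The maximal solution through \<open>\<phi>\<close> is unique on its domain \<open>{t. ereal t < te}\<close>; the choice operator
  below only picks a representative, whose values outside this domain are irrelevant.
\<close>

definition semiflow_domain ::
    "(real \<Rightarrow> 'b::real_normed_vector) set \<Rightarrow> ((real \<Rightarrow> 'b) \<Rightarrow> 'b) \<Rightarrow> (real \<times> (real \<Rightarrow> 'b)) set" where
  "semiflow_domain U f = {(t, \<phi>). 0 \<le> t \<and> \<phi> \<in> solution_manifold U f \<and>
     (\<exists>te x. maximal_solution U f \<phi> te x \<and> ereal t < te)}"

definition semiflow ::
    "(real \<Rightarrow> 'b::real_normed_vector) set \<Rightarrow> ((real \<Rightarrow> 'b) \<Rightarrow> 'b) \<Rightarrow> real \<times> (real \<Rightarrow> 'b) \<Rightarrow> real \<Rightarrow> 'b" where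
  "semiflow U f = (\<lambda>(t, \<phi>). segm {..0} (SOME x. \<exists>te. maximal_solution U f \<phi> te x) t)"

definition stationary_point ::
    "(real \<Rightarrow> 'b::real_normed_vector) set \<Rightarrow> ((real \<Rightarrow> 'b) \<Rightarrow> 'b) \<Rightarrow> (real \<Rightarrow> 'b) \<Rightarrow> bool" where
  "stationary_point U f \<phi> \<longleftrightarrow> \<phi> \<in> solution_manifold U f \<and>
     (\<forall>t\<ge>0. (t, \<phi>) \<in> semiflow_domain U f \<and> semiflow U f (t, \<phi>) = \<phi>)"

definition f_d :: "real \<Rightarrow> ((real \<Rightarrow> 'b::real_normed_vector) \<Rightarrow> 'b) \<Rightarrow> (real \<Rightarrow> 'b) \<Rightarrow> 'b" where
  "f_d d f \<phi> = f (P_d1 d \<phi>)"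

definition g_d ::
    "real \<Rightarrow> ((real \<Rightarrow> 'b::real_normed_vector) \<Rightarrow> 'b) \<Rightarrow> (real \<Rightarrow> 'b) \<Rightarrow> (real \<Rightarrow> 'b) \<Rightarrow> 'b" where
  "g_d d f \<phi>bar \<phi> = f_d d f (R_d1 d \<phi>bar + \<phi>)"


section \<open>The linear equation and its spectral decomposition\<close>

definition linear_ivp_solution ::
    "real \<Rightarrow> ((real \<Rightarrow> 'b::real_normed_vector) \<Rightarrow> 'b) \<Rightarrow> (real \<Rightarrow> 'b) \<Rightarrow> (real \<Rightarrow> 'b) \<Rightarrow> bool" where
  "linear_ivp_solution d L \<xi> v \<longleftrightarrow> continuous_on {-d..} v \<and> segm {-d..0} v 0 = \<xi> \<and>
     (\<forall>t\<ge>0. (v has_vector_derivative L (segm {-d..0} v t)) (at t within {0..}))"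

text \<open>The solution is unique on \<open>{-d..}\<close>; its values elsewhere are irrelevant.\<close>

definition linear_semigroup ::
    "real \<Rightarrow> ((real \<Rightarrow> 'b::real_normed_vector) \<Rightarrow> 'b) \<Rightarrow> real \<Rightarrow> (real \<Rightarrow> 'b) \<Rightarrow> real \<Rightarrow> 'b" where
  "linear_semigroup d L t \<xi> = segm {-d..0} (SOME v. linear_ivp_solution d L \<xi> v) t"

definition has_generator_value ::
    "'a::real_vector topology \<Rightarrow> (real \<Rightarrow> 'a \<Rightarrow> 'a) \<Rightarrow> 'a \<Rightarrow> 'a \<Rightarrow> bool" where
  "has_generator_value E T x y \<longleftrightarrow> limitin E (\<lambda>t. (1 / t) *\<^sub>R (T t x - x)) y (at_right 0)"

definition generator_dom :: "'a::real_vector topology \<Rightarrow> (real \<Rightarrow> 'a \<Rightarrow> 'a) \<Rightarrow> 'a set" where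
  "generator_dom E T = {x\<in>topspace E. \<exists>y. has_generator_value E T x y}"

definition generator :: "'a::real_vector topology \<Rightarrow> (real \<Rightarrow> 'a \<Rightarrow> 'a) \<Rightarrow> 'a \<Rightarrow> 'a" where
  "generator E T x = (THE y. has_generator_value E T x y)"

text \<open>
  Spectra are those of complexifications: \<open>(x, y)\<close> stands for \<open>x + i y\<close>, and \<open>complex_shift A z\<close> is
  \<open>A - z\<close> on the complexification. The resolvent set consists of those \<open>z\<close> for which \<open>A - z\<close> maps the
  complexified domain bijectively onto the complexified space, with continuous inverse.
\<close>

definition complex_shift ::
    "('a::real_vector \<Rightarrow> 'a) \<Rightarrow> complex \<Rightarrow> 'a \<times> 'a \<Rightarrow> 'a \<times> 'a" where
  "complex_shift A z = (\<lambda>(x, y).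
     (A x - (Re z *\<^sub>R x - Im z *\<^sub>R y), A y - (Re z *\<^sub>R y + Im z *\<^sub>R x)))"

definition operator_spectrum ::
    "'a::real_vector topology \<Rightarrow> 'a set \<Rightarrow> ('a \<Rightarrow> 'a) \<Rightarrow> complex set" where
  "operator_spectrum E D A = {z. \<not>
     (bij_betw (complex_shift A z) (D \<times> D) (topspace E \<times> topspace E) \<and>
      continuous_map (prod_topology E E) (prod_topology E E)
        (inv_into (D \<times> D) (complex_shift A z)))}"

definition finite_dimensional :: "'a::real_vector set \<Rightarrow> bool" where
  "finite_dimensional M \<longleftrightarrow> (\<exists>B. finite B \<and> M = span B)"

text \<open>
  The decomposition of \<open>E\<close> into closed subspaces which reduces the operator \<open>A\<close> with domain \<open>D\<close> and
  separates its spectrum at the imaginary axis. Since \<open>M\<^sub>c\<close> and \<open>M\<^sub>u\<close> are finite-dimensional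
  subspaces of the domain, it is unique: \<open>M\<^sub>c\<close> and \<open>M\<^sub>u\<close> are the ranges of the associated Riesz
  projections, and \<open>M\<^sub>s\<close> is the intersection of their kernels.
\<close>

definition spectral_decomposition ::
    "'a::real_vector topology \<Rightarrow> 'a set \<Rightarrow> ('a \<Rightarrow> 'a) \<Rightarrow> 'a set \<Rightarrow> 'a set \<Rightarrow> 'a set \<Rightarrow> bool" where
  "spectral_decomposition E D A Ms Mc Mu \<longleftrightarrow>
     (\<forall>M\<in>{Ms, Mc, Mu}. subspace M \<and> closedin E M \<and> A ` (D \<inter> M) \<subseteq> M) \<and>
     finite_dimensional Mc \<and> finite_dimensional Mu \<and> Mc \<subseteq> D \<and> Mu \<subseteq> D \<and>
     (\<forall>x\<in>topspace E. \<exists>!(s, c, u). s \<in> Ms \<and> c \<in> Mc \<and> u \<in> Mu \<and> x = s + c + u) \<and>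
     operator_spectrum (subtopology E Ms) (D \<inter> Ms) A = {z \<in> operator_spectrum E D A. Re z < 0} \<and>
     operator_spectrum (subtopology E Mc) (D \<inter> Mc) A = {z \<in> operator_spectrum E D A. Re z = 0} \<and>
     operator_spectrum (subtopology E Mu) (D \<inter> Mu) A = {z \<in> operator_spectrum E D A. Re z > 0}"

definition stable_center_unstable ::
    "real \<Rightarrow> ((real \<Rightarrow> 'b::real_normed_vector) \<Rightarrow> 'b) \<Rightarrow>
      (real \<Rightarrow> 'b) set \<Rightarrow> (real \<Rightarrow> 'b) set \<Rightarrow> (real \<Rightarrow> 'b) set \<Rightarrow> bool" where
  "stable_center_unstable d L Cs Cc Cu \<longleftrightarrow>
     spectral_decomposition (Cd_top d)
       (generator_dom (Cd_top d) (linear_semigroup d L))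
       (generator (Cd_top d) (linear_semigroup d L)) Cs Cc Cu"

definition center_projection ::
    "real \<Rightarrow> (real \<Rightarrow> 'b::real_normed_vector) set \<Rightarrow> (real \<Rightarrow> 'b) set \<Rightarrow> (real \<Rightarrow> 'b) set \<Rightarrow>
      (real \<Rightarrow> 'b) \<Rightarrow> real \<Rightarrow> 'b" where
  "center_projection d Cs Cc Cu \<phi> =
     (THE c. c \<in> Cc \<and> (\<exists>s\<in>C1_on {-d..0} \<inter> Cs. \<exists>u\<in>Cu. \<phi> = s + c + u))"

definition analytic_curve :: "(real \<Rightarrow> 'b::real_normed_vector) \<Rightarrow> bool" where
  "analytic_curve v \<longleftrightarrow>
     (\<forall>t0. \<exists>e>0. \<exists>a. \<forall>t. \<bar>t - t0\<bar> < e \<longrightarrow> (\<lambda>k. (t - t0) ^ k *\<^sub>R a k) sums v t)"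

definition center_solution ::
    "real \<Rightarrow> ((real \<Rightarrow> 'b::real_normed_vector) \<Rightarrow> 'b) \<Rightarrow> (real \<Rightarrow> 'b) set \<Rightarrow> (real \<Rightarrow> 'b) \<Rightarrow> real \<Rightarrow> 'b" where
  "center_solution d L Cc \<xi> = (THE v. analytic_curve v \<and>
     (\<forall>t. (v has_vector_derivative L (segm {-d..0} v t)) (at t)) \<and>
     restr {-d..0} v = \<xi> \<and> (\<forall>t. segm {-d..0} v t \<in> Cc))"

definition Y_c ::
    "real \<Rightarrow> ((real \<Rightarrow> 'b::real_normed_vector) \<Rightarrow> 'b) \<Rightarrow> (real \<Rightarrow> 'b) set \<Rightarrow> (real \<Rightarrow> 'b) set" where
  "Y_c d L Cc = (\<lambda>\<xi>. restr {..0} (center_solution d L Cc \<xi>)) ` Cc"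

text \<open>
  \<open>A\<close> is the linear part and \<open>r\<close> the globally defined nonlinear remainder; the solution is required
  to have center component \<open>\<phi>\<close> at time \<open>0\<close> and growth of at most exponential rate \<open>\<eta>\<close>.
\<close>

definition modified_solution ::
    "real \<Rightarrow> (real \<Rightarrow> 'b::real_normed_vector) set \<Rightarrow> (real \<Rightarrow> 'b) set \<Rightarrow> (real \<Rightarrow> 'b) set \<Rightarrow>
      ((real \<Rightarrow> 'b) \<Rightarrow> 'b) \<Rightarrow> ((real \<Rightarrow> 'b) \<Rightarrow> 'b) \<Rightarrow> real \<Rightarrow> (real \<Rightarrow> 'b) \<Rightarrow> (real \<Rightarrow> 'b) \<Rightarrow> bool" where
  "modified_solution d Cs Cc Cu A r \<eta> \<phi> x \<longleftrightarrow>
     x C1_differentiable_on UNIV \<and>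
     (\<forall>t. (x has_vector_derivative A (segm {-d..0} x t) + r (segm {-d..0} x t)) (at t)) \<and>
     center_projection d Cs Cc Cu (segm {-d..0} x 0) = \<phi> \<and>
     bdd_above (range (\<lambda>t. exp (- \<eta> * \<bar>t\<bar>) * norm_d1 d (segm {-d..0} x t)))"

end

theory Submission
  imports Defs
begin

text \<open>
  Write \<open>z\<close> for a solution minus the stationary point. As long as the segments of the solution stay in
  \<open>U\<^sub>*\<close>, \<open>z\<close> solves the modified equation, and its center component stays in \<open>N\<^sub>d\<^sub>,\<^sub>c\<close>. For (ii), every
  translate of \<open>z\<close> is a bounded solution on the line, so it is the one parametrized by its center
  component. For (i), start with the global modified solution through the initial value. It is
  a solution of the original equation as long as its segments are in the open set \<open>U\<^sub>*\<close>, so by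
  maximality it coincides with the given one; this agreement propagates up to time \<open>t\<close>.
\<close>

section \<open>Segments of curves and continuity of the segment map in \<open>C1_top\<close>\<close>

lemma segm_apply: "segm I x t u = (if u \<in> I then x (t + u) else 0)"
  by (simp add: segm_def restr_def)

lemma segm_cong_atMost:
  assumes "\<And>u. u \<le> t \<Longrightarrow> x u = y u"
  shows "segm {..0} x t = segm {..0} y t"
  using assms by (auto simp: segm_apply)

lemma segm_shift: "segm I (\<lambda>u. x (s + u)) t = segm I x (s + t)"
  by (simp add: segm_def add.assoc)

lemma has_vector_derivative_translate:
  assumes "(x has_vector_derivative v) (at (s + t))"
  shows "((\<lambda>u. x (s + u)) has_vector_derivative v) (at t)"
proof -
  have "((\<lambda>u. s + u) has_vector_derivative 1) (at t)"
    by (auto intro!: derivative_eq_intros)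
  from vector_diff_chain_at[OF this assms] show ?thesis
    by (simp add: o_def)
qed

lemma segm_has_vector_derivative:
  fixes w :: "real \<Rightarrow> 'b::real_normed_vector"
  assumes "(w has_vector_derivative w') (at (t + u))" and "u \<in> I"
  shows "(segm I w t has_vector_derivative w') (at u within I)"
proof -
  have "((\<lambda>v. w (t + v)) has_vector_derivative w') (at u within I)"
    by (rule has_vector_derivative_at_within[OF has_vector_derivative_translate[OF assms(1)]])
  then show ?thesis
    by (rule has_vector_derivative_transform[rotated 2])
      (use assms(2) in \<open>auto simp: segm_apply\<close>)
qed

text \<open>Every u \<le> 0, including the endpoint 0, is approached from the left inside
  \<open>{..0}\<close>, so the derivative within \<open>{..0}\<close> is unique there.\<close>

lemma deriv_on_atMost_eq:
  assumes "(\<phi> has_vector_derivative v) (at u within {..0})" and "u \<le> 0"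
  shows "deriv_on {..0} \<phi> u = v"
proof -
  have "at_left u \<le> at u within {..0}"
    by (rule at_le) (use assms(2) in auto)
  then have "at u within {..0} \<noteq> bot"
    using trivial_limit_at_left_real[of u] by (metis bot.extremum_uniqueI)
  then show ?thesis
    unfolding deriv_on_def using assms(1) by (rule vector_derivative_within)
qed

lemma segm_in_C1_on:
  fixes w w' :: "real \<Rightarrow> 'b::real_normed_vector"
  assumes w: "\<And>t. (w has_vector_derivative w' t) (at t)" and w': "continuous_on UNIV w'"
  shows "segm I w t \<in> C1_on I"
  unfolding C1_on_def
proof (intro CollectI conjI exI ballI allI impI)
  show "segm I w t s = 0" if "s \<notin> I" for s using that by (simp add: segm_apply)
  show "continuous_on I (\<lambda>u. w' (t + u))"
    by (intro continuous_on_compose2[OF w'] continuous_intros) auto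
  show "(segm I w t has_vector_derivative w' (t + u)) (at u within I)" if "u \<in> I" for u
    using w that by (rule segm_has_vector_derivative)
qed

lemma sup_norm_segm_diff_less:
  fixes w :: "real \<Rightarrow> 'b::real_normed_vector"
  assumes "continuous_on UNIV w" and "0 < k" and "0 < e"
  shows "\<exists>\<delta>>0. \<forall>t. \<bar>t - s\<bar> < \<delta> \<longrightarrow> sup_norm {-k..0} (\<lambda>u. w (t + u) - w (s + u)) < e"
proof -
  \<comment> \<open>This compact window contains s + u and t + u whenever u lies in [-k, 0] and t is
    within distance 1 of s. Strict bounds yield only a weak bound for the supremum, hence e / 2
    below.\<close>
  let ?K = "{s - k - 1..s + 1}"
  have "uniformly_continuous_on ?K w"
    by (intro compact_uniformly_continuous compact_Icc continuous_on_subset[OF assms(1)]) auto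
  then obtain \<delta> where \<delta>: "\<delta> > 0"
    "\<And>a b. a \<in> ?K \<Longrightarrow> b \<in> ?K \<Longrightarrow> dist b a < \<delta> \<Longrightarrow> dist (w b) (w a) < e / 2"
    unfolding uniformly_continuous_on_def using assms(3) by (metis half_gt_zero)
  show ?thesis
  proof (intro exI conjI allI impI)
    show "min \<delta> 1 > 0" using \<delta> by simp
    fix t assume t: "\<bar>t - s\<bar> < min \<delta> 1"
    have "sup_norm {-k..0} (\<lambda>u. w (t + u) - w (s + u)) \<le> e / 2"
      unfolding sup_norm_def
    proof (rule cSUP_least)
      show "{-k..0} \<noteq> {}" using assms(2) by simp
      fix u assume u: "u \<in> {-k..0}"
      have "dist (w (t + u)) (w (s + u)) < e / 2"
        using t u by (intro \<delta>(2)) (auto simp: dist_real_def)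
      then show "norm (w (t + u) - w (s + u)) \<le> e / 2" by (simp add: dist_norm)
    qed
    then show "sup_norm {-k..0} (\<lambda>u. w (t + u) - w (s + u)) < e" using assms(3) by simp
  qed
qed

text \<open>A basic neighbourhood tests finitely many seminorms, each on some compact [-k, 0]. There
  uniform continuity of \<open>w\<close> and of \<open>w'\<close> keeps the segments close. This is
  what lets a curve remain in an open set slightly beyond a given time.\<close>

lemma segm_in_open:
  fixes w w' :: "real \<Rightarrow> 'b::real_normed_vector"
  assumes w: "\<And>t. (w has_vector_derivative w' t) (at t)" and w': "continuous_on UNIV w'"
    and Q: "openin C1_top Q" and s: "segm {..0} w s \<in> Q"
  shows "\<exists>\<delta>>0. \<forall>t. \<bar>t - s\<bar> < \<delta> \<longrightarrow> segm {..0} w t \<in> Q"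
proof -
  let ?P = "{(\<lambda>\<phi>::real \<Rightarrow> 'b. sup_norm {-k..0} \<phi> + sup_norm {-k..0} (deriv_on {..0} \<phi>)) |k. 0 < k}"
  have "\<exists>F e. finite F \<and> F \<subseteq> ?P \<and> 0 < e \<and> {y\<in>C1_on {..0}. \<forall>p\<in>F. p (y - segm {..0} w s) < e} \<subseteq> Q"
    using Q s unfolding C1_top_def openin_seminorm_topology by blast
  then obtain F e where F: "finite F" "F \<subseteq> ?P" "0 < e"
    "{y\<in>C1_on {..0}. \<forall>p\<in>F. p (y - segm {..0} w s) < e} \<subseteq> Q"
    by blast
  have cw: "continuous_on UNIV w"
    using w by (meson continuous_at_imp_continuous_on has_vector_derivative_continuous)
  have "\<forall>\<^sub>F t in nhds s. p (segm {..0} w t - segm {..0} w s) < e" if p: "p \<in> F" for p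
  proof -
    from p F(2) obtain k where k: "0 < k"
      "p = (\<lambda>\<phi>. sup_norm {-k..0} \<phi> + sup_norm {-k..0} (deriv_on {..0} \<phi>))"
      by blast
    obtain \<delta>1 where \<delta>1: "\<delta>1 > 0"
      "\<And>t. \<bar>t - s\<bar> < \<delta>1 \<Longrightarrow> sup_norm {-k..0} (\<lambda>u. w (t + u) - w (s + u)) < e / 2"
      using sup_norm_segm_diff_less[OF cw k(1), of "e / 2"] F(3) by auto
    obtain \<delta>2 where \<delta>2: "\<delta>2 > 0"
      "\<And>t. \<bar>t - s\<bar> < \<delta>2 \<Longrightarrow> sup_norm {-k..0} (\<lambda>u. w' (t + u) - w' (s + u)) < e / 2"
      using sup_norm_segm_diff_less[OF w' k(1), of "e / 2"] F(3) by auto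
    have "p (segm {..0} w t - segm {..0} w s) < e" if t: "dist t s < min \<delta>1 \<delta>2" for t
    proof -
      have d0: "(segm {..0} w t - segm {..0} w s) u = w (t + u) - w (s + u)" if "u \<in> {-k..0}" for u
        using that by (simp add: segm_apply)
      have d1: "deriv_on {..0} (segm {..0} w t - segm {..0} w s) u = w' (t + u) - w' (s + u)"
        if "u \<in> {-k..0}" for u
      proof (rule deriv_on_atMost_eq)
        have "u \<in> {..0}" using that by simp
        from segm_has_vector_derivative[OF w this] segm_has_vector_derivative[OF w this]
        show "(segm {..0} w t - segm {..0} w s has_vector_derivative w' (t + u) - w' (s + u))
            (at u within {..0})"
          unfolding fun_diff_def by (rule has_vector_derivative_diff)
      qed (use that in auto)
      have "p (segm {..0} w t - segm {..0} w s) =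
          sup_norm {-k..0} (\<lambda>u. w (t + u) - w (s + u)) + sup_norm {-k..0} (\<lambda>u. w' (t + u) - w' (s + u))"
        unfolding k(2) sup_norm_def
        by (intro arg_cong2[where f = "(+)"] SUP_cong refl arg_cong[where f = norm] d0 d1)
      also have "\<dots> < e / 2 + e / 2"
        using t by (intro add_strict_mono \<delta>1 \<delta>2) (auto simp: dist_real_def)
      finally show ?thesis by simp
    qed
    then show ?thesis
      unfolding eventually_nhds_metric using \<delta>1(1) \<delta>2(1) by (intro exI[of _ "min \<delta>1 \<delta>2"]) auto
  qed
  then have "\<forall>\<^sub>F t in nhds s. \<forall>p\<in>F. p (segm {..0} w t - segm {..0} w s) < e"
    using F(1) by (intro eventually_ball_finite) auto
  then obtain \<delta> where "\<delta> > 0"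
    "\<And>t. dist t s < \<delta> \<Longrightarrow> \<forall>p\<in>F. p (segm {..0} w t - segm {..0} w s) < e"
    unfolding eventually_nhds_metric by auto
  then show ?thesis
    using F(4) segm_in_C1_on[OF w w', of "{..0}"] by (intro exI[of _ \<delta>]) (auto simp: dist_real_def)
qed

section \<open>Stationary points, regularity of entire solutions, and time translation\<close>

lemma stationary_point_const:
  assumes "stationary_point U f \<phi>" and "s \<le> 0"
  shows "\<phi> s = \<phi> 0"
proof -
  let ?x = "SOME x. \<exists>te. maximal_solution U f \<phi> te x"
  have *: "segm {..0} ?x t = \<phi>" if "t \<ge> 0" for t
    using assms(1) that by (auto simp: stationary_point_def semiflow_def)
  \<comment> \<open>The segment at time -s evaluated at s and the segment at time 0 evaluated at 0
    both read off \<open>?x 0\<close>.\<close>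
  have "\<phi> s = ?x 0" using fun_cong[OF *[of "- s"], of s] assms(2) by (simp add: segm_apply)
  also have "\<dots> = \<phi> 0" using fun_cong[OF *[of 0], of 0] by (simp add: segm_apply)
  finally show ?thesis .
qed

text \<open>\<open>is_solution\<close> provides derivatives only pointwise, whereas
  \<open>modified_solution\<close> asks for a continuously differentiable map. Continuity of the
  derivative is recovered from the segments.\<close>

lemma continuous_derivative_of_C1_segments:
  fixes y y' :: "real \<Rightarrow> 'b::real_normed_vector"
  assumes y: "\<And>t. (y has_vector_derivative y' t) (at t)"
    and seg: "\<And>t. segm {..0} y t \<in> C1_on {..0}"
  shows "continuous_on UNIV y'"
proof (intro continuous_at_imp_continuous_on ballI)
  fix t :: real
  \<comment> \<open>The segment at t + 1 sees t at the interior point -1, which gives two-sided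
    continuity at t. The segment at t would give only left continuity.\<close>
  obtain \<phi>' where \<phi>': "continuous_on {..0} \<phi>'"
    "\<And>s. s \<le> 0 \<Longrightarrow> (segm {..0} y (t + 1) has_vector_derivative \<phi>' s) (at s within {..0})"
    using seg[of "t + 1"] unfolding C1_on_def by auto
  have eq: "y' u = \<phi>' (u - (t + 1))" if "u \<le> t + 1" for u
  proof -
    have "(segm {..0} y (t + 1) has_vector_derivative y' u) (at (u - (t + 1)) within {..0})"
      using that by (intro segm_has_vector_derivative) (auto simp: y)
    from deriv_on_atMost_eq[OF this] deriv_on_atMost_eq[OF \<phi>'(2), of "u - (t + 1)"] show ?thesis
      using that by simp
  qed
  have "continuous_on {..<t + 1} (\<lambda>u. \<phi>' (u - (t + 1)))"
    by (intro continuous_on_compose2[OF \<phi>'(1)] continuous_intros) auto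
  then have "continuous_on {..<t + 1} y'"
    by (rule continuous_on_eq) (use eq in auto)
  then show "isCont y' t"
    by (simp add: continuous_on_eq_continuous_at)
qed

text \<open>The equation is autonomous, and since |s + t| - |t| \<le> |s| the translation by s costs
  only the factor exp(\<eta> |s|) in the growth bound. Thus a characterization by the center
  component at time 0 becomes available at every time s.\<close>

lemma modified_solution_shift:
  assumes x: "modified_solution d Cs Cc Cu A r \<eta> \<phi> x" and "0 \<le> \<eta>"
  shows "modified_solution d Cs Cc Cu A r \<eta>
    (center_projection d Cs Cc Cu (segm {-d..0} x s)) (\<lambda>u. x (s + u))"
  unfolding modified_solution_def
proof (intro conjI allI)
  from x obtain D where D: "\<And>t. (x has_vector_derivative D t) (at t)" "continuous_on UNIV D"
    unfolding modified_solution_def C1_differentiable_on_def by auto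
  show "(\<lambda>u. x (s + u)) C1_differentiable_on UNIV"
    unfolding C1_differentiable_on_def
  proof (intro exI[of _ "\<lambda>u. D (s + u)"] conjI ballI)
    show "continuous_on UNIV (\<lambda>u. D (s + u))"
      by (intro continuous_on_compose2[OF D(2)] continuous_intros) auto
  qed (rule has_vector_derivative_translate[OF D(1)])
  fix t
  show "((\<lambda>u. x (s + u)) has_vector_derivative
      A (segm {-d..0} (\<lambda>u. x (s + u)) t) + r (segm {-d..0} (\<lambda>u. x (s + u)) t)) (at t)"
    unfolding segm_shift
    by (rule has_vector_derivative_translate) (use x in \<open>simp add: modified_solution_def\<close>)
next
  show "center_projection d Cs Cc Cu (segm {-d..0} (\<lambda>u. x (s + u)) 0) =
      center_projection d Cs Cc Cu (segm {-d..0} x s)"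
    by (simp add: segm_shift)
  obtain B where B: "\<And>t. exp (- \<eta> * \<bar>t\<bar>) * norm_d1 d (segm {-d..0} x t) \<le> B"
    using x unfolding modified_solution_def bdd_above_def by auto
  show "bdd_above (range (\<lambda>t. exp (- \<eta> * \<bar>t\<bar>) * norm_d1 d (segm {-d..0} (\<lambda>u. x (s + u)) t)))"
  proof (intro bdd_aboveI2)
    fix t
    let ?v = "norm_d1 d (segm {-d..0} x (s + t))"
    have "exp (- \<eta> * \<bar>t\<bar>) * ?v = exp (\<eta> * (\<bar>s + t\<bar> - \<bar>t\<bar>)) * (exp (- \<eta> * \<bar>s + t\<bar>) * ?v)"
      by (simp add: mult_exp_exp right_diff_distrib flip: mult.assoc)
    \<comment> \<open>\<open>max 0 B\<close> is nonnegative, so the exponential factor in front of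
      it may be enlarged next.\<close>
    also have "\<dots> \<le> exp (\<eta> * (\<bar>s + t\<bar> - \<bar>t\<bar>)) * max 0 B"
      using B[of "s + t"] by (intro mult_left_mono) auto
    also have "\<dots> \<le> exp (\<eta> * \<bar>s\<bar>) * max 0 B"
      using assms(2) by (intro mult_right_mono) (auto intro!: mult_left_mono)
    finally show "exp (- \<eta> * \<bar>t\<bar>) * norm_d1 d (segm {-d..0} (\<lambda>u. x (s + u)) t) \<le>
        exp (\<eta> * \<bar>s\<bar>) * max 0 B"
      by (simp add: segm_shift)
  qed
qed

theorem proposition17p1:
  fixes f :: "(real \<Rightarrow> real^'n) \<Rightarrow> real^'n"
    and U N Ud Cs Cc Cu Ndc Ustar Wc N\<Delta> :: "(real \<Rightarrow> real^'n) set"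
    and \<phi>bar :: "real \<Rightarrow> real^'n"
    and d \<Delta> \<eta>1 :: real
    and L Dg r :: "(real \<Rightarrow> real^'n) \<Rightarrow> real^'n"
    and nrm :: "(real \<Rightarrow> real^'n) \<Rightarrow> real"
    and xb J :: "(real \<Rightarrow> real^'n) \<Rightarrow> real \<Rightarrow> real^'n"
  assumes "openin C1_top U"
    and "C1F_on C1_top euclidean U f"
    and "property_e U f"
    and "stationary_point U f \<phi>bar"
    \<comment> \<open>choice of N, d, U_d\<close>
    and "openin C1_top N" and "\<phi>bar \<in> N" and "N \<subseteq> U"
    and "0 < d"
    and "\<forall>\<xi>\<in>N. \<forall>\<psi>\<in>N. (\<forall>s\<in>{-d..0}. \<xi> s = \<psi> s) \<longrightarrow> f \<xi> = f \<psi>"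
    and "openin (C1d_top d) Ud" and "R_d1 d \<phi>bar \<in> Ud" and "P_d1 d ` Ud \<subseteq> N"
    \<comment> \<open>the extended derivative of f_d and the spectral decomposition\<close>
    and "continuous_linear_between (Cd_top d) euclidean L"
    and "\<forall>\<xi>\<in>C1_on {-d..0}. L \<xi> = dirderiv euclidean (f_d d f) (R_d1 d \<phi>bar) \<xi>"
    and "stable_center_unstable d L Cs Cc Cu"
    and "Cc \<subseteq> C1_on {-d..0}" and "Cu \<subseteq> C1_on {-d..0}"
    and "Cc \<noteq> {0}"
    \<comment> \<open>the norm on C^1_d and the modified equation\<close>
    and "norm_on (C1_on {-d..0}) nrm"
    and "equivalent_norms (C1_on {-d..0}) nrm (norm_d1 d)"
    and "\<forall>k. Ck_on k (subtopology (C1d_top d) Cc) (Cc - {0}) nrm"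
    and "0 < \<Delta>" and "N\<Delta> = {\<phi>\<in>C1_on {-d..0}. nrm \<phi> < \<Delta>}"
    and "N\<Delta> \<subseteq> (\<lambda>\<phi>. \<phi> - R_d1 d \<phi>bar) ` Ud"
    and "Dg = dirderiv euclidean (g_d d f \<phi>bar) 0"
    and "\<forall>\<phi>\<in>N\<Delta>. r \<phi> = g_d d f \<phi>bar \<phi> - Dg \<phi>"
    and "\<exists>l<1. \<forall>\<phi>\<in>C1_on {-d..0}. \<forall>\<psi>\<in>C1_on {-d..0}. norm (r \<phi> - r \<psi>) \<le> l * nrm (\<phi> - \<psi>)"
    and "0 < \<eta>1"
    and "\<forall>\<phi>\<in>Cc. \<forall>x. modified_solution d Cs Cc Cu Dg r \<eta>1 \<phi> x \<longleftrightarrow> x = xb \<phi>"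
    and "xb 0 = 0"
    and "J = (\<lambda>\<phi>. \<phi>bar + restr {..0} (xb \<phi>))"
    and "C1F_on (subtopology (C1d_top d) Cc) C1_top Cc J"
    and "\<forall>\<xi>\<in>Cc. dirderiv C1_top J 0 \<xi> = restr {..0} (center_solution d L Cc \<xi>)"
    \<comment> \<open>the local center manifold and the neighbourhood U_*\<close>
    and "openin (subtopology (C1d_top d) Cc) Ndc" and "0 \<in> Ndc"
    and "Wc = J ` Ndc"
    and "C1F_submanifold C1_top Wc"
    and "tangent_set C1_top Wc \<phi>bar = Y_c d L Cc"
    and "Wc \<subseteq> N"
    and "\<forall>\<phi>\<in>Ndc. nrm (segm {-d..0} (xb \<phi>) 0) < \<Delta>"
    and "Wc \<subseteq> solution_manifold U f"
    and "openin C1_top Ustar" and "\<phi>bar \<in> Ustar" and "Ustar \<subseteq> N"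
    and "R_d1 d ` Ustar \<subseteq> Ud \<inter> (\<lambda>\<phi>. \<phi> + R_d1 d \<phi>bar) ` N\<Delta>"
    and "\<forall>\<psi>\<in>Ustar. center_projection d Cs Cc Cu (R_d1 d (\<psi> - \<phi>bar)) \<in> Ndc"
  shows "(\<forall>t \<psi>. (t, \<psi>) \<in> semiflow_domain U f \<and> \<psi> \<in> Wc \<and>
            semiflow U f ` ({0..t} \<times> {\<psi>}) \<subseteq> Ustar \<longrightarrow>
            semiflow U f ` ({0..t} \<times> {\<psi>}) \<subseteq> Wc) \<and>
         (\<forall>y. is_solution U f UNIV y \<and> (\<forall>t. segm {..0} y t \<in> Ustar) \<longrightarrow>
            (\<forall>t. segm {..0} y t \<in> Wc))"
proof -

  \<comment> \<open>Reduction to the modified equation near the stationary point\<close>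
  note U_open = assms(1) and stat = assms(4) and N_U = assms(7)
    and f_N = assms(9) and P_N = assms(12)
    and equiv = assms(20) and N\<Delta> = assms(23)
    and \<Delta> = assms(22) and r = assms(26) and \<eta>1 = assms(28) and xb = assms(29) and J = assms(31)
    and Ndc_open = assms(34) and Wc = assms(36)
    and Us_open = assms(42) and Us_N = assms(44) and Us_d = assms(45) and Us_c = assms(46)
  define c where "c = \<phi>bar 0"
  have \<phi>bar: "\<phi>bar s = c" if "s \<le> 0" for s
    using stationary_point_const[OF stat that] by (simp add: c_def)
  have Ndc: "Ndc \<subseteq> Cc" using openin_subset[OF Ndc_open] by auto

  \<comment> \<open>Maps on \<open>{..0}\<close> are extended by 0, so \<open>\<phi>bar\<close>
    equals \<open>c\<close> only up to time 0. Both facts enter when \<open>J\<close> is compared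
    with a segment as a function on all reals.\<close>
  have \<phi>bar_zero: "\<phi>bar s = 0" if "s > 0" for s
    using stat that openin_subset[OF U_open]
    by (auto simp: stationary_point_def solution_manifold_def C1_top_def C1_on_def)
  have R: "R_d1 d (segm {..0} (\<lambda>u. c + z u) t - \<phi>bar) = segm {-d..0} z t" for z t
    using \<phi>bar by (auto simp: R_d1_def restr_def segm_apply fun_eq_iff)
  \<comment> \<open>On \<open>N\<close> the value of \<open>f\<close> depends only on the
    restriction to [-d, 0]. Hence \<theta> may be replaced by
    \<open>P_d1 d (R_d1 d \<theta>)\<close>, which turns \<open>f\<close> into \<open>g_d\<close>,
    and on \<open>N\<Delta>\<close> the map \<open>g_d\<close> is \<open>Dg\<close> plus the
    remainder \<open>r\<close>.\<close>
  have in_N\<Delta>: "R_d1 d (\<theta> - \<phi>bar) \<in> N\<Delta>" and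
    f_eq: "f \<theta> = Dg (R_d1 d (\<theta> - \<phi>bar)) + r (R_d1 d (\<theta> - \<phi>bar))" if \<theta>: "\<theta> \<in> Ustar" for \<theta>
  proof -
    let ?\<zeta> = "R_d1 d (\<theta> - \<phi>bar)"
    have sum: "R_d1 d \<phi>bar + ?\<zeta> = R_d1 d \<theta>"
      by (auto simp: R_d1_def restr_def fun_eq_iff)
    obtain \<phi> where "\<phi> \<in> N\<Delta>" "R_d1 d \<theta> = \<phi> + R_d1 d \<phi>bar" and Ud: "R_d1 d \<theta> \<in> Ud"
      using Us_d \<theta> by blast
    then show \<zeta>: "?\<zeta> \<in> N\<Delta>" using sum by (metis add.commute add_left_cancel)
    have "f \<theta> = f (P_d1 d (R_d1 d \<theta>))"
    proof (rule f_N[rule_format])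
      show "\<theta> \<in> N" using \<theta> Us_N by blast
      show "P_d1 d (R_d1 d \<theta>) \<in> N" using P_N Ud by blast
      fix s assume "s \<in> {-d..0}"
      then show "\<theta> s = P_d1 d (R_d1 d \<theta>) s"
        by (simp add: P_d1_def R_d1_def restr_def)
    qed
    also have "\<dots> = g_d d f \<phi>bar ?\<zeta>"
      by (simp add: g_d_def f_d_def sum)
    also have "\<dots> = Dg ?\<zeta> + r ?\<zeta>" using r \<zeta> by simp
    finally show "f \<theta> = Dg ?\<zeta> + r ?\<zeta>" .
  qed
  \<comment> \<open>Both claims end here. The translate of z by s is a modified solution whose
    center component \<open>?p\<close> lies in \<open>Ndc\<close> because the segment is in
    \<open>Ustar\<close>. Uniqueness identifies the translate with \<open>xb ?p\<close>, so the
    segment is \<open>J ?p\<close>.\<close>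
  have in_Wc: "segm {..0} (\<lambda>u. c + z u) s \<in> Wc"
    if z: "modified_solution d Cs Cc Cu Dg r \<eta>1 \<phi> z" and s: "segm {..0} (\<lambda>u. c + z u) s \<in> Ustar"
    for z s \<phi>
  proof -
    let ?p = "center_projection d Cs Cc Cu (segm {-d..0} z s)"
    have p: "?p \<in> Ndc" using Us_c s R by metis
    have "modified_solution d Cs Cc Cu Dg r \<eta>1 ?p (\<lambda>u. z (s + u))"
      using z less_imp_le[OF \<eta>1] by (rule modified_solution_shift)
    then have xb_p: "xb ?p = (\<lambda>u. z (s + u))"
      using bspec[OF xb subsetD[OF Ndc p]] by simp
    have "J ?p = segm {..0} (\<lambda>u. c + z u) s"
      unfolding J xb_p using \<phi>bar \<phi>bar_zero by (auto simp: restr_def segm_apply fun_eq_iff)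
    then show ?thesis using p unfolding Wc by (metis image_eqI)
  qed

  show ?thesis
  proof (intro conjI allI impI)

    \<comment> \<open>Local positive invariance\<close>
    fix t \<psi>
    assume A: "(t, \<psi>) \<in> semiflow_domain U f \<and> \<psi> \<in> Wc \<and> semiflow U f ` ({0..t} \<times> {\<psi>}) \<subseteq> Ustar"
    \<comment> \<open>This is the representative chosen in \<open>semiflow\<close>. The witness
      \<open>x0\<close> from \<open>semiflow_domain\<close> may be another one, so the two end times
      are compared by maximality.\<close>
    define x where "x = (SOME x. \<exists>te. maximal_solution U f \<psi> te x)"
    obtain te0 x0 where t0: "0 \<le> t" "ereal t < te0" and x0: "maximal_solution U f \<psi> te0 x0"
      using A by (auto simp: semiflow_domain_def)
    have "\<exists>te. maximal_solution U f \<psi> te x"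
      unfolding x_def by (rule someI[of _ x0]) (use x0 in blast)
    then obtain te where x: "maximal_solution U f \<psi> te x" by blast
    have "te0 \<le> te" using x x0 unfolding maximal_solution_def by blast
    with t0 have te: "ereal t < te" by simp
    have x_sol: "is_solution U f {t. 0 \<le> t \<and> ereal t < te} x" and x_init: "segm {..0} x 0 = \<psi>"
      and x_max: "\<And>te' y. 0 < te' \<Longrightarrow> is_solution U f {t. 0 \<le> t \<and> ereal t < te'} y \<Longrightarrow>
        segm {..0} y 0 = \<psi> \<Longrightarrow> (\<forall>t. ereal t < te' \<longrightarrow> y t = x t)"
      using x unfolding maximal_solution_def by blast+
    have flow: "semiflow U f (s, \<psi>) = segm {..0} x s" for s
      by (simp add: semiflow_def x_def)
    have x_Us: "segm {..0} x s \<in> Ustar" if "0 \<le> s" "s \<le> t" for s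
      using A that flow by (metis (no_types, lifting) SigmaI atLeastAtMost_iff image_subset_iff singletonI)

    obtain \<phi> where \<phi>: "\<phi> \<in> Ndc" "\<psi> = J \<phi>" using A Wc by blast
    define z where "z = xb \<phi>"
    define w where "w = (\<lambda>u. c + z u)"
    have z: "modified_solution d Cs Cc Cu Dg r \<eta>1 \<phi> z" using xb \<phi>(1) Ndc z_def by blast
    have w_init: "segm {..0} w 0 = \<psi>"
      unfolding \<phi>(2) J w_def z_def using \<phi>bar \<phi>bar_zero
      by (auto simp: restr_def segm_apply fun_eq_iff)
    obtain D where D: "\<And>t. (z has_vector_derivative D t) (at t)" "continuous_on UNIV D"
      using z unfolding modified_solution_def C1_differentiable_on_def by auto
    have wD: "(w has_vector_derivative D t) (at t)" for t
      unfolding w_def using D(1)[of t] by (auto intro!: derivative_eq_intros)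
    \<comment> \<open>The global curve \<open>w\<close> obeys the original equation only at times
      when its segment lies in \<open>Ustar\<close>; that this holds up to t is not known in
      advance.\<close>
    have w_eq: "(w has_vector_derivative f (segm {..0} w s)) (at s)" if "segm {..0} w s \<in> Ustar" for s
    proof -
      have "f (segm {..0} w s) = Dg (segm {-d..0} z s) + r (segm {-d..0} z s)"
        using f_eq[OF that] R[of z s] by (simp add: w_def)
      then have "(z has_vector_derivative f (segm {..0} w s)) (at s)"
        using z by (simp add: modified_solution_def)
      then show ?thesis unfolding w_def by (auto intro!: derivative_eq_intros)
    qed

    \<comment> \<open>Continuation argument: \<open>S\<close> collects the times up to which
      \<open>x\<close> and \<open>w\<close> agree. Its supremum \<open>m\<close> is shown to be
      attained and then to equal t.\<close>
    define S where "S = {s \<in> {0..t}. \<forall>u\<le>s. x u = w u}"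
    have "0 \<in> S"
    proof -
      have "x u = w u" if "u \<le> 0" for u
        using that fun_cong[OF x_init[folded w_init], of u] by (simp add: segm_apply)
      then show ?thesis using t0 by (simp add: S_def)
    qed
    have S_bdd: "bdd_above S" by (rule bdd_aboveI[of _ t]) (simp add: S_def)
    define m where "m = Sup S"
    have m: "0 \<le> m" "m \<le> t"
      unfolding m_def using \<open>0 \<in> S\<close> S_bdd by (auto intro!: cSup_upper cSup_least simp: S_def)
    have below: "x u = w u" if "u < m" for u
    proof -
      obtain s where "s \<in> S" "u < s"
        using \<open>u < m\<close> less_cSup_iff[OF _ S_bdd] \<open>0 \<in> S\<close> unfolding m_def by blast
      then show ?thesis by (simp add: S_def)
    qed
    \<comment> \<open>For m > 0 both curves are continuous on [0, m] and agree on [0, m), so they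
      agree at m.\<close>
    have "m \<in> S"
    proof (cases "m = 0")
      case False
      then have "0 < m" using m by simp
      have sub: "{0..m} \<subseteq> {t. 0 \<le> t \<and> ereal t < te}"
        using m te by (auto intro: le_less_trans[of _ "ereal t"])
      have "continuous_on {t. 0 \<le> t \<and> ereal t < te} x"
        using x_sol unfolding is_solution_def continuous_on_eq_continuous_within
        using has_vector_derivative_continuous by blast
      then have "continuous_on {0..m} x" by (rule continuous_on_subset) (rule sub)
      moreover have "continuous_on {0..m} w"
        using wD by (meson continuous_at_imp_continuous_on has_vector_derivative_continuous)
      ultimately have "continuous_on (closure {0..<m}) (\<lambda>u. x u - w u)"
        using \<open>0 < m\<close> by (simp add: continuous_on_diff)
      then have "x m - w m = 0"
        by (rule continuous_constant_on_closure) (use below \<open>0 < m\<close> in auto)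
      then have "x u = w u" if "u \<le> m" for u using below[of u] that by (cases "u = m") auto
      then show ?thesis using m by (simp add: S_def)
    qed (use \<open>0 \<in> S\<close> in simp)
    have seg: "segm {..0} x s = segm {..0} w s" if "s \<le> m" for s
      using \<open>m \<in> S\<close> that by (intro segm_cong_atMost) (auto simp: S_def)
    \<comment> \<open>If m < t, the common segment at m lies in the open set \<open>Ustar\<close>,
      so \<open>w\<close> solves the original equation on [0, m + e). Maximality of \<open>x\<close>
      then forces agreement beyond m.\<close>
    have "m = t"
    proof (rule ccontr)
      assume "m \<noteq> t"
      have "segm {..0} w m \<in> Ustar" using x_Us[OF m] seg by simp
      from segm_in_open[OF wD D(2) Us_open this]
      obtain e where e: "e > 0" "\<And>s. \<bar>s - m\<bar> < e \<Longrightarrow> segm {..0} w s \<in> Ustar" by blast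
      have w_Us: "segm {..0} w s \<in> Ustar" if "0 \<le> s" "s < m + e" for s
        using that m x_Us[of s] seg[of s] e by (cases "s \<le> m") auto
      have "is_solution U f {t. 0 \<le> t \<and> ereal t < ereal (m + e)} w"
        unfolding is_solution_def
      proof (intro ballI conjI)
        fix s assume "s \<in> {t. 0 \<le> t \<and> ereal t < ereal (m + e)}"
        then have s: "segm {..0} w s \<in> Ustar" by (intro w_Us) auto
        then show "segm {..0} w s \<in> U" using Us_N N_U by blast
        show "(w has_vector_derivative f (segm {..0} w s))
            (at s within {t. 0 \<le> t \<and> ereal t < ereal (m + e)})"
          by (rule has_vector_derivative_at_within[OF w_eq[OF s]])
      qed
      from x_max[OF _ this w_init] have "w u = x u" if "u < m + e" for u
        using that m e(1) by simp
      \<comment> \<open>This time stays in [0, t], lies below m + e, and exceeds m when m <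
        t.\<close>
      then have "min t (m + e / 2) \<in> S"
        using m e(1) t0 by (auto simp: S_def min_def)
      then have "min t (m + e / 2) \<le> m" unfolding m_def by (rule cSup_upper[OF _ S_bdd])
      then show False using \<open>m \<noteq> t\<close> m e(1) by linarith
    qed
    have "segm {..0} x s \<in> Wc" if "0 \<le> s" "s \<le> t" for s
      using in_Wc[OF z, of s] x_Us[OF that] seg[of s] that \<open>m = t\<close> by (simp add: w_def)
    then show "semiflow U f ` ({0..t} \<times> {\<psi>}) \<subseteq> Wc" using flow by auto
  next

    \<comment> \<open>Entire solutions with all segments in \<open>Ustar\<close>\<close>
    fix y t
    assume y: "is_solution U f UNIV y \<and> (\<forall>t. segm {..0} y t \<in> Ustar)"
    define z where "z = (\<lambda>u. y u - c)"
    have yz: "y = (\<lambda>u. c + z u)" by (simp add: z_def)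
    have y': "(y has_vector_derivative f (segm {..0} y t)) (at t)" for t
      using y by (simp add: is_solution_def)
    then have z': "(z has_vector_derivative f (segm {..0} y t)) (at t)" for t
      unfolding z_def by (auto intro!: derivative_eq_intros)
    have seg_C1: "segm {..0} y t \<in> C1_on {..0}" for t
      using y openin_subset[OF Us_open] by (auto simp: C1_top_def)
    have R_y: "R_d1 d (segm {..0} y t - \<phi>bar) = segm {-d..0} z t" for t
      using R[of z t] by (simp add: yz)
    have "modified_solution d Cs Cc Cu Dg r \<eta>1 (center_projection d Cs Cc Cu (segm {-d..0} z 0)) z"
      unfolding modified_solution_def
    proof (intro conjI allI refl)
      show "z C1_differentiable_on UNIV"
        unfolding C1_differentiable_on_def
        by (intro exI[of _ "\<lambda>t. f (segm {..0} y t)"] conjI ballI z'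
            continuous_derivative_of_C1_segments[OF y' seg_C1])
      show "(z has_vector_derivative Dg (segm {-d..0} z t) + r (segm {-d..0} z t)) (at t)" for t
        using z'[of t] f_eq[of "segm {..0} y t"] y R_y by simp
      \<comment> \<open>All segments of z lie in \<open>N\<Delta>\<close>, so the equivalence of
        norms bounds them in \<open>norm_d1\<close> by \<Delta> / a uniformly in time. The
        exponential weight is at most 1.\<close>
      obtain a where a: "a > 0" "\<And>\<zeta>. \<zeta> \<in> C1_on {-d..0} \<Longrightarrow> a * norm_d1 d \<zeta> \<le> nrm \<zeta>"
        using equiv unfolding equivalent_norms_def by blast
      show "bdd_above (range (\<lambda>t. exp (- \<eta>1 * \<bar>t\<bar>) * norm_d1 d (segm {-d..0} z t)))"
      proof (intro bdd_aboveI2)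
        fix t
        have "segm {-d..0} z t \<in> N\<Delta>" using in_N\<Delta>[of "segm {..0} y t"] y R_y by simp
        then have "a * norm_d1 d (segm {-d..0} z t) \<le> \<Delta>"
          using a(2) unfolding N\<Delta> by (smt (verit) mem_Collect_eq)
        then have "norm_d1 d (segm {-d..0} z t) \<le> \<Delta> / a"
          using a(1) by (simp add: field_simps)
        then have "exp (- \<eta>1 * \<bar>t\<bar>) * norm_d1 d (segm {-d..0} z t) \<le> exp (- \<eta>1 * \<bar>t\<bar>) * (\<Delta> / a)"
          by (intro mult_left_mono) auto
        also have "\<dots> \<le> 1 * (\<Delta> / a)"
          using \<eta>1 a(1) \<Delta> by (intro mult_right_mono) auto
        finally show "exp (- \<eta>1 * \<bar>t\<bar>) * norm_d1 d (segm {-d..0} z t) \<le> \<Delta> / a" by simp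
      qed
    qed
    from in_Wc[OF this, of t] show "segm {..0} y t \<in> Wc" using y unfolding yz by simp
  qed
qed

end
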